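(* Let $\mathcal{K} \in \mathbb{K}^*$ and consider any instance of $(QP)$ whose feasible region $S$ is nonempty and bounded (a nonempty polytope). Then, for any local minimizer $\tilde{x} \in S$ of $(QP)$, \[ \ell_{\mathcal{K}}(\tilde{x}) = q(\tilde{x}). \] In particular, for any global minimizer $x^* \in S$ of $(QP)$, $\ell_{\mathcal{K}}(x^* ) = q(x^* ) = \ell^*$.
   Context: Quadratic program: let $Q \in \mathbb{R}^{n\times n}$ be symmetric, $c \in \mathbb{R}^n$, $A \in \mathbb{R}^{m \times n}$, $b \in \mathbb{R}^m$; put $q(x) = x^T Q x + 2c^T x$ and $S = \{x \in \mathbb{R}^n : Ax = b,\ x \ge 0\}$. $(QP)$ is the problem of minimizing $q(x)$ over $x \in S$, with optimal value $\ell^*$. Local minimizers are with respect to $S$. $\mathcal{S}^N$ denotes the real symmetric $N\times N$ matrices, and $\langle U,V\rangle = \sum_{i,j} U_{ij}V_{ij}$. $\mathcal{D}^N$ is the cone of doubly nonnegative matrices (positive semidefinite and entrywise nonnegative) in $\mathcal{S}^N$, and $\mathcal{CP}^N = \{\sum_{j=1}^k y^j (y^j)^T : k \ge 1,\ y^j \in \mathbb{R}^N_+\}$ is the cone of completely positive matrices. $\mathbb{K}^*$ is the family of all closed convex cones $\mathcal{K} \subseteq \mathcal{S}^{n+1}$ with $\mathcal{CP}^{n+1} \subseteq \mathcal{K} \subseteq \mathcal{D}^{n+1}$. Rows and columns of matrices in $\mathcal{S}^{n+1}$ are indexed by $0,1,\ldots,n$. Let \[ \widehat{Q} = \begin{bmatrix}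 0 & c^T \\ c & Q\end{bmatrix}, \qquad \widehat{A} = \begin{bmatrix} b^Tb & -b^TA \\ -A^Tb & A^TA\end{bmatrix}. \] For $\tilde{x} \in S$, $\ell_{\mathcal{K}}(\tilde{x})$ is the optimal value (infimum) of the problem $(P(\mathcal{K},\tilde{x}))$: minimize $\langle \widehat{Q}, Y\rangle$ subject to $\langle \widehat{A}, Y\rangle = 0$, $(Y_{01},\ldots,Y_{0n}) = \tilde{x}^T$, $Y_{00} = 1$, $Y \in \mathcal{K}$. *)

theory Defs
  imports "HOL-Analysis.Analysis"
begin

definition qp_obj :: "real^'n^'n \<Rightarrow> real^'n \<Rightarrow> real^'n \<Rightarrow> real" where
  "qp_obj Q c x = x \<bullet> (Q *v x) + 2 * (c \<bullet> x)"

definition qp_feasible :: "real^'n^'m \<Rightarrow> real^'m \<Rightarrow> (real^'n) set" where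
  "qp_feasible A b = {x. A *v x = b \<and> (\<forall>i. 0 \<le> x $ i)}"

(* Optimal values are infima in the extended reals, so that no attainment or
   boundedness is presupposed. *)
definition qp_value :: "real^'n^'n \<Rightarrow> real^'n \<Rightarrow> real^'n^'m \<Rightarrow> real^'m \<Rightarrow> ereal" where
  "qp_value Q c A b = (INF x\<in>qp_feasible A b. ereal (qp_obj Q c x))"

definition local_minimizer_on :: "('a::metric_space \<Rightarrow> real) \<Rightarrow> 'a set \<Rightarrow> 'a \<Rightarrow> bool" where
  "local_minimizer_on f S x \<longleftrightarrow> x \<in> S \<and> (\<exists>e>0. \<forall>y \<in> S \<inter> ball x e. f x \<le> f y)"

definition global_minimizer_on :: "('a \<Rightarrow> real) \<Rightarrow> 'a set \<Rightarrow> 'a \<Rightarrow> bool" where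
  "global_minimizer_on f S x \<longleftrightarrow> x \<in> S \<and> (\<forall>y \<in> S. f x \<le> f y)"

definition symmetric_mat :: "real^'k^'k \<Rightarrow> bool" where
  "symmetric_mat M \<longleftrightarrow> transpose M = M"

definition psd_mat :: "real^'k^'k \<Rightarrow> bool" where
  "psd_mat M \<longleftrightarrow> symmetric_mat M \<and> (\<forall>x. 0 \<le> x \<bullet> (M *v x))"

definition doubly_nonnegative :: "(real^'k^'k) set" where
  "doubly_nonnegative = {M. psd_mat M \<and> (\<forall>i j. 0 \<le> M $ i $ j)}"

definition outer_square :: "real^'k \<Rightarrow> real^'k^'k" where
  "outer_square y = (\<chi> i j. y $ i * y $ j)"

definition completely_positive :: "(real^'k^'k) set" where
  "completely_positive =
     {\<Sum>j=1..k. outer_square (y j) | (k::nat) (y :: nat \<Rightarrow> real^'k).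
        k \<ge> 1 \<and> (\<forall>j\<in>{1..k}. \<forall>i. 0 \<le> y j $ i)}"

(* The members of K_star consist of symmetric matrices because doubly_nonnegative does. *)
definition K_star :: "(real^'k^'k) set set" where
  "K_star = {K. closed K \<and> convex_cone K \<and>
                completely_positive \<subseteq> K \<and> K \<subseteq> doubly_nonnegative}"

(* The index set {0,1,...,n} is the type 'n option: None is the index 0 and
   Some i is the index i of the original variables.  bordered a r s M is the
   block matrix with corner a, top row r, left column s and lower right block M. *)
definition bordered ::
    "real \<Rightarrow> real^'n \<Rightarrow> real^'n \<Rightarrow> real^'n^'n \<Rightarrow> real^('n option)^('n option)" where
  "bordered a r s M =
     (\<chi> i j. case i of
               None \<Rightarrow> (case j of None \<Rightarrow> a | Some l \<Rightarrow> r $ l)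
             | Some k \<Rightarrow> (case j of None \<Rightarrow> s $ k | Some l \<Rightarrow> M $ k $ l))"

definition Q_hat :: "real^'n^'n \<Rightarrow> real^'n \<Rightarrow> real^('n option)^('n option)" where
  "Q_hat Q c = bordered 0 c c Q"

definition A_hat :: "real^'n^'m \<Rightarrow> real^'m \<Rightarrow> real^('n option)^('n option)" where
  "A_hat A b = bordered (b \<bullet> b) (- (b v* A)) (- (transpose A *v b)) (transpose A ** A)"

(* On matrices, the library's inner product is the entrywise (trace) inner product. *)
definition lifted_feasible ::
    "real^'n^'m \<Rightarrow> real^'m \<Rightarrow> (real^('n option)^('n option)) set \<Rightarrow> real^'n
       \<Rightarrow> (real^('n option)^('n option)) set" where
  "lifted_feasible A b K x =
     {Y \<in> K. A_hat A b \<bullet> Y = 0 \<and> (\<forall>j. Y $ None $ Some j = x $ j) \<and> Y $ None $ None = 1}"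

definition lifted_value ::
    "real^'n^'n \<Rightarrow> real^'n \<Rightarrow> real^'n^'m \<Rightarrow> real^'m \<Rightarrow> (real^('n option)^('n option)) set
       \<Rightarrow> real^'n \<Rightarrow> ereal" where
  "lifted_value Q c A b K x = (INF Y\<in>lifted_feasible A b K x. ereal (Q_hat Q c \<bullet> Y))"

end

theory Submission
  imports Defs
begin

text \<open>
  The point \<open>x\<close> lifts to the rank-one matrix of \<open>(1, x)\<close>, which gives the upper bound. Conversely, let
  \<open>Y\<close> be feasible with lower right block \<open>X\<close>, and let \<open>M = X - x x\<^sup>T\<close> be its Schur complement, so that
  the claim is \<open>\<langle>Q, M\<rangle> \<ge> 0\<close>. As \<open>A x = b\<close>, the constraint \<open>\<langle>A_hat, Y\<rangle> = 0\<close> says \<open>tr (A M A\<^sup>T) = 0\<close>,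
  hence \<open>A M = 0\<close>. If \<open>x\<^sub>j = 0\<close>, then the \<open>j\<close>-th column of \<open>X\<close> is a nonnegative vector in the kernel of
  \<open>A\<close>, so it vanishes because the polytope has no recession direction. The columns of \<open>M\<close> therefore lie
  in the subspace of those directions along which one can move from \<open>x\<close> both ways within the polytope.
  Local minimality makes \<open>Q\<close> positive semidefinite on this subspace, and pivoting writes \<open>M\<close> as a sum
  of squares of vectors in it.
\<close>

section \<open>Positive semidefinite matrices: Cauchy-Schwarz, pivoting, sums of squares in a
  subspace\<close>

lemma quadratic_nonneg_discriminant:
  fixes a b c :: real
  assumes "\<And>t. 0 \<le> a + 2 * t * b + t\<^sup>2 * c"
  shows "b\<^sup>2 \<le> a * c"
proof (cases "c = 0")
  case True
  have "b = 0"
  proof (rule ccontr)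
    assume "b \<noteq> 0"
    \<comment> \<open>At this point the affine function \<open>a + 2 * t * b\<close> takes the value
      -1.\<close>
    with assms[of "- (a + 1) / (2 * b)"] True show False
      by (simp add: field_simps)
  qed
  with True show ?thesis by simp
next
  case False
  have "0 < c"
  proof (rule ccontr)
    assume "\<not> 0 < c"
    with False have c: "c < 0" by simp
    \<comment> \<open>The quotient and the added 1 make \<open>t * (- c)\<close> exceed
      \<open>1 + |a| + 2 * |b|\<close> while \<open>1 <= t\<close>, so the negative quadratic term
      outweighs the other two.\<close>
    define t where "t = (1 + \<bar>a\<bar> + 2 * \<bar>b\<bar>) / (- c) + 1"
    have t1: "1 \<le> t" using c by (simp add: t_def divide_nonneg_neg)
    have tc: "t * (- c) = 1 + \<bar>a\<bar> + 2 * \<bar>b\<bar> - c"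
      using c by (simp add: t_def field_simps)
    have "t * (t * (- c)) \<ge> t * (1 + \<bar>a\<bar> + 2 * \<bar>b\<bar>)"
      using tc t1 c by (intro mult_left_mono) auto
    moreover have "t * \<bar>b\<bar> \<ge> t * b" using t1 by (intro mult_left_mono) auto
    moreover have "t * (1 + \<bar>a\<bar>) \<ge> 1 * (1 + \<bar>a\<bar>)" using t1 by (intro mult_right_mono) auto
    ultimately have "a + 2 * t * b + t\<^sup>2 * c < 0"
      by (simp add: power2_eq_square algebra_simps)
    with assms[of t] show False by simp
  qed
  \<comment> \<open>The minimizer of the parabola.\<close>
  with assms[of "- b / c"] show ?thesis
    by (simp add: power2_eq_square field_simps)
qed

lemma symmetric_mat_nth: "symmetric_mat M \<Longrightarrow> M $ i $ j = M $ j $ i"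
  unfolding symmetric_mat_def by (metis (no_types) transpose_def vec_lambda_beta)

lemma symmetric_mat_inner_commute:
  "symmetric_mat M \<Longrightarrow> w \<bullet> (M *v z) = z \<bullet> (M *v w)"
  by (metis dot_lmul_matrix inner_commute symmetric_mat_def transpose_matrix_vector)

lemma psd_cauchy_schwarz:
  assumes "psd_mat M"
  shows "(z \<bullet> (M *v w))\<^sup>2 \<le> (z \<bullet> (M *v z)) * (w \<bullet> (M *v w))"
proof (rule quadratic_nonneg_discriminant)
  fix t :: real
  have "0 \<le> (z + t *\<^sub>R w) \<bullet> (M *v (z + t *\<^sub>R w))"
    using assms by (simp add: psd_mat_def)
  also have "\<dots> = z \<bullet> (M *v z) + 2 * t * (z \<bullet> (M *v w)) + t\<^sup>2 * (w \<bullet> (M *v w))"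
    using symmetric_mat_inner_commute[of M w z] assms
    by (simp add: psd_mat_def matrix_vector_right_distrib matrix_vector_mult_scaleR
        inner_add_left inner_add_right power2_eq_square algebra_simps)
  finally show "0 \<le> z \<bullet> (M *v z) + 2 * t * (z \<bullet> (M *v w)) + t\<^sup>2 * (w \<bullet> (M *v w))" .
qed

text \<open>Cauchy-Schwarz for the pair \<open>M *v z\<close>, \<open>z\<close> bounds the fourth
  power of the norm of \<open>M *v z\<close> by a multiple of
  \<open>z \<bullet> (M *v z)\<close>.\<close>

lemma psd_kernel:
  assumes "psd_mat M" "z \<bullet> (M *v z) = 0"
  shows "M *v z = 0"
  using psd_cauchy_schwarz[OF assms(1), of "M *v z" z] assms(2) by simp

lemma inner_matrix_eq: "(M :: real^'k^'l) \<bullet> N = (\<Sum>i\<in>UNIV. \<Sum>j\<in>UNIV. M $ i $ j * N $ i $ j)"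
  by (simp add: inner_vec_def)

lemma inner_matrix_vector_eq:
  "(z :: real^'k) \<bullet> (M *v w) = (\<Sum>i\<in>UNIV. \<Sum>j\<in>UNIV. M $ i $ j * (z $ i * w $ j))"
  by (simp add: inner_vec_def matrix_vector_mult_def sum_distrib_left algebra_simps)

lemma inner_outer_square: "M \<bullet> outer_square v = v \<bullet> (M *v v)"
  by (simp add: inner_matrix_eq inner_matrix_vector_eq outer_square_def)

lemma outer_square_mult_vec: "outer_square v *v z = (v \<bullet> z) *\<^sub>R v"
  by (simp add: vec_eq_iff outer_square_def matrix_vector_mult_def inner_vec_def
      sum_distrib_left mult_ac)

lemma symmetric_outer_square: "symmetric_mat (outer_square v)"
  by (simp add: symmetric_mat_def transpose_def outer_square_def vec_eq_iff mult.commute)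

lemma inner_axis_mult: "axis i 1 \<bullet> ((M :: real^'k^'k) *v z) = (M *v z) $ i"
  by (simp add: inner_axis')

lemma mult_axis_nth: "((M :: real^'k^'k) *v axis j 1) $ i = M $ i $ j"
  by (simp add: matrix_vector_mul_component inner_axis)

lemma mult_axis_column: "(M :: real^'k^'k) *v axis j 1 = column j M"
  by (simp add: vec_eq_iff mult_axis_nth column_def)

lemma psd_diag_nonneg: "psd_mat M \<Longrightarrow> 0 \<le> M $ i $ i"
  unfolding psd_mat_def by (metis inner_axis_mult mult_axis_nth)

text \<open>One step of symmetric Gaussian elimination. Cauchy-Schwarz against the
  \<open>i\<close>-th unit vector bounds the subtracted square by the form of
  \<open>M\<close>.\<close>

lemma psd_pivot:
  assumes M: "psd_mat M" and i: "M $ i $ i \<noteq> 0"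
  shows "psd_mat (M - (1 / M $ i $ i) *\<^sub>R outer_square (column i M))"
proof -
  let ?v = "column i M"
  have pos: "0 < M $ i $ i"
    using psd_diag_nonneg[OF M, of i] i by simp
  have sym: "symmetric_mat (M - (1 / M $ i $ i) *\<^sub>R outer_square ?v)"
    using M symmetric_outer_square[of ?v]
    by (simp add: psd_mat_def symmetric_mat_def transpose_def vec_eq_iff)
  have "0 \<le> z \<bullet> ((M - (1 / M $ i $ i) *\<^sub>R outer_square ?v) *v z)" for z
  proof -
    have "?v \<bullet> z = z \<bullet> (M *v axis i 1)"
      by (simp add: mult_axis_column inner_commute)
    then have "(?v \<bullet> z)\<^sup>2 \<le> (z \<bullet> (M *v z)) * M $ i $ i"
      using psd_cauchy_schwarz[OF M, of z "axis i 1"]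
      by (simp add: inner_axis_mult mult_axis_nth)
    then have "(?v \<bullet> z)\<^sup>2 / M $ i $ i \<le> z \<bullet> (M *v z)"
      using pos by (simp add: field_simps)
    moreover have "z \<bullet> ((M - (1 / M $ i $ i) *\<^sub>R outer_square ?v) *v z)
        = z \<bullet> (M *v z) - (?v \<bullet> z)\<^sup>2 / M $ i $ i"
      by (simp add: matrix_vector_mult_diff_rdistrib inner_diff_right
          scaleR_matrix_vector_assoc[symmetric] outer_square_mult_vec inner_commute power2_eq_square)
    ultimately show ?thesis by simp
  qed
  with sym show ?thesis by (simp add: psd_mat_def)
qed

text \<open>Induction on the number of nonzero diagonal entries. A pivot clears one of them, revives
  none, and changes columns only by multiples of a column in \<open>L\<close>. The square it splits
  off pairs with \<open>Q\<close> to a nonnegative number, being the square of a vector of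
  \<open>L\<close>.\<close>

lemma psd_inner_nonneg_on_subspace:
  fixes M Q :: "real^'k^'k"
  assumes "subspace L" and Q: "\<And>d. d \<in> L \<Longrightarrow> 0 \<le> d \<bullet> (Q *v d)"
    and "psd_mat M" and "\<And>i. column i M \<in> L"
  shows "0 \<le> Q \<bullet> M"
  using assms(3,4)
proof (induction "card {i. M $ i $ i \<noteq> 0}" arbitrary: M rule: less_induct)
  case less
  note M = less.prems(1)
  have zero: "M $ j $ k = 0" if "M $ k $ k = 0" for j k
  proof -
    have "M *v axis k 1 = 0"
      using psd_kernel[OF M, of "axis k 1"] that by (simp add: inner_axis_mult mult_axis_nth)
    then show ?thesis by (metis mult_axis_nth zero_index)
  qed
  show ?case
  proof (cases "\<exists>i. M $ i $ i \<noteq> 0")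
    case False
    then have "M = 0" by (simp add: vec_eq_iff zero)
    then show ?thesis by simp
  next
    case True
    then obtain i where i: "M $ i $ i \<noteq> 0" by blast
    let ?v = "column i M"
    define N where "N = M - (1 / M $ i $ i) *\<^sub>R outer_square ?v"
    have pos: "0 < M $ i $ i"
      using psd_diag_nonneg[OF M, of i] i by simp
    have N_diag: "N $ k $ k = M $ k $ k - (M $ k $ i)\<^sup>2 / M $ i $ i" for k
      by (simp add: N_def outer_square_def column_def power2_eq_square)
    have "N $ k $ k = 0" if "M $ k $ k = 0" for k
      using zero[OF that, of i] symmetric_mat_nth[of M k i] M that
      by (simp add: N_diag psd_mat_def)
    moreover have "N $ i $ i = 0"
      using i by (simp add: N_diag power2_eq_square)
    ultimately have "{k. N $ k $ k \<noteq> 0} \<subset> {k. M $ k $ k \<noteq> 0}"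
      using i by blast
    then have "card {k. N $ k $ k \<noteq> 0} < card {k. M $ k $ k \<noteq> 0}"
      by (simp add: psubset_card_mono)
    moreover have "psd_mat N"
      unfolding N_def using M i by (rule psd_pivot)
    moreover have "column j N \<in> L" for j
    proof -
      have "column j N = column j M - (M $ j $ i / M $ i $ i) *\<^sub>R ?v"
        by (simp add: vec_eq_iff N_def column_def outer_square_def)
      then show ?thesis
        using less.prems(2) \<open>subspace L\<close> by (simp add: subspace_diff subspace_scale)
    qed
    ultimately have "0 \<le> Q \<bullet> N" by (rule less.hyps)
    moreover have "M = N + (1 / M $ i $ i) *\<^sub>R outer_square ?v" by (simp add: N_def)
    then have "Q \<bullet> M = Q \<bullet> N + (?v \<bullet> (Q *v ?v)) / M $ i $ i"
      by (metis inner_add_right inner_outer_square inner_scaleR_right mult.commute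
          times_divide_eq_right mult.right_neutral)
    moreover have "0 \<le> ?v \<bullet> (Q *v ?v)" using Q less.prems(2) by blast
    ultimately show ?thesis using pos by simp
  qed
qed

section \<open>Directions at a feasible point and the second order condition\<close>

lemma bounded_qp_feasible_no_recession:
  assumes bdd: "bounded (qp_feasible A b)" and x: "x \<in> qp_feasible A b"
    and d: "A *v d = 0" "\<And>i. 0 \<le> d $ i"
  shows "d = 0"
proof (rule ccontr)
  assume "d \<noteq> 0"
  obtain B where B: "\<And>y. y \<in> qp_feasible A b \<Longrightarrow> norm y \<le> B"
    using bdd by (auto simp: bounded_iff)
  \<comment> \<open>Two points of norm at most \<open>B\<close> and \<open>norm x\<close> differ by
    at most \<open>B + norm x\<close>; this step is longer by 1.\<close>
  define t where "t = (B + norm x + 1) / norm d"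
  have "0 \<le> B" using B[OF x] norm_ge_zero[of x] by linarith
  then have t: "0 \<le> t" by (simp add: t_def)
  then have "x + t *\<^sub>R d \<in> qp_feasible A b"
    using x d by (simp add: qp_feasible_def matrix_vector_right_distrib matrix_vector_mult_scaleR)
  then have "norm (x + t *\<^sub>R d) \<le> B" by (rule B)
  moreover have "norm (t *\<^sub>R d) = B + norm x + 1"
    using \<open>d \<noteq> 0\<close> \<open>0 \<le> B\<close> t by (simp add: t_def)
  moreover have "norm (t *\<^sub>R d) \<le> norm (x + t *\<^sub>R d) + norm x"
    by (metis add_diff_cancel_left' norm_triangle_ineq4)
  ultimately show False by simp
qed

text \<open>For feasible \<open>x\<close>, the lineality space of the cone of feasible directions at
  \<open>x\<close>, or equivalently the direction space of the smallest face containing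
  \<open>x\<close>.\<close>

definition lineality_at :: "real^'n^'m \<Rightarrow> real^'n \<Rightarrow> (real^'n) set" where
  "lineality_at A x = {d. A *v d = 0 \<and> (\<forall>i. x $ i = 0 \<longrightarrow> d $ i = 0)}"

lemma subspace_lineality_at: "subspace (lineality_at A x)"
  by (auto simp: subspace_def lineality_at_def matrix_vector_right_distrib
      matrix_vector_mult_scaleR)

text \<open>Zero coordinates of \<open>x\<close> stay zero, and each of the finitely many positive
  ones stays positive for small \<open>t\<close>.\<close>

lemma eventually_feasible_along_lineality:
  assumes x: "x \<in> qp_feasible A b" and d: "d \<in> lineality_at A x"
  shows "\<forall>\<^sub>F t in at_right 0. x + t *\<^sub>R d \<in> qp_feasible A b"
proof -
  have "\<forall>\<^sub>F t in at_right 0. 0 \<le> x $ i + t * d $ i" for i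
  proof (cases "x $ i = 0")
    case True
    then show ?thesis using d by (simp add: lineality_at_def)
  next
    case False
    moreover have "0 \<le> x $ i" using x by (simp add: qp_feasible_def)
    ultimately have "0 < x $ i" by simp
    moreover have "((\<lambda>t. x $ i + t * d $ i) \<longlongrightarrow> x $ i + 0 * d $ i) (at_right 0)"
      by (intro tendsto_intros)
    ultimately have "\<forall>\<^sub>F t in at_right 0. 0 < x $ i + t * d $ i"
      by (intro order_tendstoD) auto
    then show ?thesis by (rule eventually_mono) simp
  qed
  then have "\<forall>\<^sub>F t in at_right 0. \<forall>i. 0 \<le> x $ i + t * d $ i"
    by (rule eventually_all_finite)
  then show ?thesis
    by (rule eventually_mono)
      (use x d in \<open>simp add: qp_feasible_def lineality_at_def matrix_vector_right_distrib
        matrix_vector_mult_scaleR\<close>)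
qed

text \<open>Both \<open>d\<close> and \<open>- d\<close> are feasible directions, so the objective
  decreases along neither for small steps; adding the two inequalities isolates the
  curvature.\<close>

lemma local_minimizer_curvature_nonneg:
  assumes x: "local_minimizer_on (qp_obj Q c) (qp_feasible A b) x"
    and d: "d \<in> lineality_at A x"
  shows "0 \<le> d \<bullet> (Q *v d)"
proof -
  obtain e where e: "e > 0"
    and min: "\<And>y. y \<in> qp_feasible A b \<Longrightarrow> dist x y < e \<Longrightarrow> qp_obj Q c x \<le> qp_obj Q c y"
    and feas: "x \<in> qp_feasible A b"
    using x by (auto simp: local_minimizer_on_def)
  have along: "\<forall>\<^sub>F t in at_right 0. qp_obj Q c x \<le> qp_obj Q c (x + t *\<^sub>R u)"
    if "u \<in> lineality_at A x" for u
  proof -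
    have "((\<lambda>t. dist x (x + t *\<^sub>R u)) \<longlongrightarrow> dist x (x + 0 *\<^sub>R u)) (at_right 0)"
      by (intro tendsto_intros)
    then have "\<forall>\<^sub>F t in at_right 0. dist x (x + t *\<^sub>R u) < e"
      using e by (intro order_tendstoD) auto
    with eventually_feasible_along_lineality[OF feas that] show ?thesis
      by eventually_elim (rule min)
  qed
  have "- d \<in> lineality_at A x"
    using subspace_lineality_at d by (rule subspace_neg)
  from along[OF d] along[OF this] eventually_at_right_less
  have "\<forall>\<^sub>F t in at_right (0::real). 0 \<le> d \<bullet> (Q *v d)"
  proof eventually_elim
    case (elim t)
    \<comment> \<open>The first order terms cancel in the sum of the two increments.\<close>
    have "qp_obj Q c (x + t *\<^sub>R d) + qp_obj Q c (x + t *\<^sub>R - d)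
        = 2 * qp_obj Q c x + 2 * (t * t * (d \<bullet> (Q *v d)))"
      by (simp add: qp_obj_def matrix_vector_right_distrib matrix_vector_mult_diff_distrib
          matrix_vector_mult_scaleR inner_add_left inner_add_right inner_diff_left
          inner_diff_right algebra_simps)
    with elim have "0 \<le> t * t * (d \<bullet> (Q *v d))" by linarith
    moreover have "0 < t * t" using elim(3) by simp
    ultimately show ?case by (simp only: zero_le_mult_iff) linarith
  qed
  then show ?thesis by simp
qed

section \<open>Block matrices, the lifted constraint and the Schur complement\<close>

lemma sum_UNIV_option:
  "(\<Sum>i\<in>UNIV. f i) = f None + (\<Sum>i\<in>UNIV. f (Some i))"
  for f :: "'a::finite option \<Rightarrow> 'b::comm_monoid_add"
  by (simp add: UNIV_option_conv sum.reindex)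

lemma bordered_inner_bordered:
  "bordered a r s M \<bullet> bordered a' r' s' M' = a * a' + r \<bullet> r' + s \<bullet> s' + M \<bullet> M'"
  by (simp add: inner_matrix_eq sum_UNIV_option bordered_def inner_vec_def sum.distrib)

lemma eq_bordered:
  assumes "symmetric_mat Y" "\<And>j. Y $ None $ Some j = x $ j" "Y $ None $ None = 1"
  shows "Y = bordered 1 x x (\<chi> i j. Y $ Some i $ Some j)"
  using assms symmetric_mat_nth[OF assms(1), of "Some _" None]
  by (simp add: vec_eq_iff bordered_def split: option.split)

lemma outer_square_lift:
  "outer_square (\<chi> i. case i of None \<Rightarrow> 1 | Some k \<Rightarrow> x $ k) = bordered 1 x x (outer_square x)"
  by (simp add: vec_eq_iff outer_square_def bordered_def split: option.split)

lemma Q_hat_inner_bordered: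
  "Q_hat Q c \<bullet> bordered 1 x x X = Q \<bullet> X + 2 * (c \<bullet> x)"
  by (simp add: Q_hat_def bordered_inner_bordered)

lemma Q_hat_inner_lift:
  "Q_hat Q c \<bullet> bordered 1 x x (outer_square x) = qp_obj Q c x"
  by (simp add: Q_hat_inner_bordered inner_outer_square qp_obj_def)

text \<open>Both sides are the trace of \<open>A M A\<^sup>T\<close>. For positive semidefinite
  \<open>M\<close> the summands are nonnegative, so a zero trace makes each of them vanish.\<close>

lemma gram_inner:
  "(transpose A ** A) \<bullet> M = (\<Sum>k\<in>UNIV. row k A \<bullet> (M *v row k A))"
  for A :: "real^'n^'m"
proof -
  have "(transpose A ** A) \<bullet> M = (\<Sum>i\<in>UNIV. \<Sum>j\<in>UNIV. \<Sum>k\<in>UNIV. A $ k $ i * A $ k $ j * M $ i $ j)"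
    by (simp add: inner_matrix_eq matrix_matrix_mult_def transpose_def sum_distrib_right)
  also have "\<dots> = (\<Sum>i\<in>UNIV. \<Sum>k\<in>UNIV. \<Sum>j\<in>UNIV. A $ k $ i * A $ k $ j * M $ i $ j)"
    by (intro sum.cong refl sum.swap)
  also have "\<dots> = (\<Sum>k\<in>UNIV. \<Sum>i\<in>UNIV. \<Sum>j\<in>UNIV. A $ k $ i * A $ k $ j * M $ i $ j)"
    by (rule sum.swap)
  also have "\<dots> = (\<Sum>k\<in>UNIV. row k A \<bullet> (M *v row k A))"
    by (simp add: inner_matrix_vector_eq row_def mult_ac)
  finally show ?thesis .
qed

text \<open>The corner gives \<open>b \<bullet> b\<close> and each border gives its negative. What
  remains, \<open>- (b \<bullet> b)\<close>, is the pairing of the Gram matrix with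
  \<open>- outer_square x\<close>.\<close>

lemma A_hat_inner_bordered:
  assumes "A *v x = b"
  shows "A_hat A b \<bullet> bordered 1 x x X = (transpose A ** A) \<bullet> (X - outer_square x)"
proof -
  have "x \<bullet> ((transpose A ** A) *v x) = b \<bullet> b"
    by (metis assms dot_lmul_matrix inner_commute matrix_vector_mul_assoc transpose_matrix_vector
        transpose_transpose)
  moreover have "(b v* A) \<bullet> x = b \<bullet> b" using assms by (simp add: dot_lmul_matrix)
  ultimately show ?thesis
    by (simp add: A_hat_def bordered_inner_bordered inner_diff_right inner_outer_square
        transpose_matrix_vector)
qed

lemma psd_schur_complement:
  assumes Y: "psd_mat (bordered 1 x x X)"
  shows "psd_mat (X - outer_square x)"
proof -
  have "X $ i $ j = X $ j $ i" for i j
    using symmetric_mat_nth[of "bordered 1 x x X" "Some i" "Some j"] Y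
    by (simp add: psd_mat_def bordered_def)
  then have "symmetric_mat (X - outer_square x)"
    by (simp add: symmetric_mat_def vec_eq_iff transpose_def outer_square_def)
  moreover have "0 \<le> z \<bullet> ((X - outer_square x) *v z)" for z
  proof -
    \<comment> \<open>For a given \<open>z\<close>, the entry \<open>- (x \<bullet> z)\<close> at
      \<open>None\<close> minimizes the bordered form, and the minimum is the form of the Schur
      complement at \<open>z\<close>.\<close>
    let ?y = "\<chi> i. case i of None \<Rightarrow> - (x \<bullet> z) | Some k \<Rightarrow> z $ k"
    have y: "outer_square ?y = bordered ((x \<bullet> z)\<^sup>2) (- (x \<bullet> z) *\<^sub>R z) (- (x \<bullet> z) *\<^sub>R z) (outer_square z)"
      by (simp add: vec_eq_iff outer_square_def bordered_def power2_eq_square split: option.split)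
    have "0 \<le> ?y \<bullet> (bordered 1 x x X *v ?y)"
      using Y by (simp add: psd_mat_def)
    also have "\<dots> = bordered 1 x x X \<bullet> outer_square ?y"
      by (simp add: inner_outer_square)
    also have "\<dots> = z \<bullet> (X *v z) - (x \<bullet> z)\<^sup>2"
      unfolding y by (simp add: bordered_inner_bordered inner_outer_square power2_eq_square)
    also have "\<dots> = z \<bullet> ((X - outer_square x) *v z)"
      by (simp add: matrix_vector_mult_diff_rdistrib outer_square_mult_vec inner_diff_right
          inner_commute power2_eq_square)
    finally show ?thesis .
  qed
  ultimately show ?thesis by (simp add: psd_mat_def)
qed

lemma schur_complement_column_lineality:
  fixes A :: "real^'n^'m"
  assumes bdd: "bounded (qp_feasible A b)" and x: "x \<in> qp_feasible A b"
    and Y: "bordered 1 x x X \<in> doubly_nonnegative" "A_hat A b \<bullet> bordered 1 x x X = 0"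
  shows "column j (X - outer_square x) \<in> lineality_at A x"
proof -
  let ?M = "X - outer_square x"
  have Ax: "A *v x = b" using x by (simp add: qp_feasible_def)
  have M: "psd_mat ?M"
    using Y(1) by (intro psd_schur_complement) (simp add: doubly_nonnegative_def)
  have "(\<Sum>k\<in>UNIV. row k A \<bullet> (?M *v row k A)) = 0"
    using Y(2) Ax by (simp add: A_hat_inner_bordered flip: gram_inner)
  then have "row k A \<bullet> (?M *v row k A) = 0" for k
    using M by (simp add: sum_nonneg_eq_0_iff psd_mat_def)
  then have ker: "?M *v row k A = 0" for k
    using psd_kernel[OF M] by blast
  have AM: "A *v column l ?M = 0" for l
  proof -
    \<comment> \<open>By symmetry of \<open>?M\<close>, the vectors \<open>?M *v row k A\<close> are
      the rows of the product of \<open>A\<close> and \<open>?M\<close>.\<close>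
    have "(A *v column l ?M) $ k = (?M *v row k A) $ l" for k
      using M symmetric_mat_nth[of ?M]
      by (simp add: psd_mat_def matrix_vector_mult_def column_def row_def mult.commute)
    then show ?thesis by (simp add: vec_eq_iff ker)
  qed
  \<comment> \<open>Entrywise nonnegativity of the lifted matrix and boundedness of the polytope
    meet here: where \<open>x\<close> vanishes, the correction \<open>outer_square x\<close> drops
    out, so the column of \<open>X\<close> is a recession direction.\<close>
  have Xcol: "column l X = 0" if "x $ l = 0" for l
  proof (rule bounded_qp_feasible_no_recession[OF bdd x])
    have "column l X = column l ?M"
      using that by (simp add: column_def outer_square_def vec_eq_iff)
    then show "A *v column l X = 0" using AM by simp
    show "0 \<le> column l X $ i" for i
    proof -
      have "0 \<le> bordered 1 x x X $ Some i $ Some l"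
        using Y(1) by (simp add: doubly_nonnegative_def)
      then show ?thesis by (simp add: bordered_def column_def)
    qed
  qed
  \<comment> \<open>Symmetry turns the vanishing column \<open>i\<close> into a vanishing
    \<open>i\<close>-th coordinate of every column.\<close>
  have "column j ?M $ i = 0" if "x $ i = 0" for i
  proof -
    have "column j ?M $ i = ?M $ j $ i"
      using M symmetric_mat_nth[of ?M] by (simp add: psd_mat_def column_def)
    also have "\<dots> = column i X $ j" using that by (simp add: column_def outer_square_def)
    finally show ?thesis using Xcol[OF that] by simp
  qed
  with AM show ?thesis by (simp add: lineality_at_def)
qed

section \<open>The upper and lower bounds for the lifted value\<close>

lemma lift_in_lifted_feasible:
  assumes K: "K \<in> K_star" and x: "x \<in> qp_feasible A b"
  shows "bordered 1 x x (outer_square x) \<in> lifted_feasible A b K x"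
proof -
  let ?y = "\<chi> i. case i of None \<Rightarrow> 1 | Some k \<Rightarrow> x $ k"
  have "outer_square ?y \<in> completely_positive"
    unfolding completely_positive_def
    \<comment> \<open>A single summand suffices, namely the square of the nonnegative vector
      \<open>(1, x)\<close>.\<close>
    by (rule CollectI, rule exI[of _ 1], rule exI[of _ "\<lambda>_. ?y"])
      (use x in \<open>auto simp: qp_feasible_def split: option.split\<close>)
  then have "bordered 1 x x (outer_square x) \<in> K"
    using K by (auto simp: K_star_def outer_square_lift)
  moreover have "A_hat A b \<bullet> bordered 1 x x (outer_square x) = 0"
    using x by (simp add: A_hat_inner_bordered qp_feasible_def)
  ultimately show ?thesis
    by (simp add: lifted_feasible_def) (simp add: bordered_def)
qed

text \<open>The linear terms of the two objectives agree, so their gap is the pairing of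
  \<open>Q\<close> with the Schur complement, whose columns lie where \<open>Q\<close> has
  nonnegative curvature.\<close>

lemma lifted_feasible_lower_bound:
  assumes K: "K \<in> K_star" and bdd: "bounded (qp_feasible A b)"
    and x: "local_minimizer_on (qp_obj Q c) (qp_feasible A b) x"
    and Y: "Y \<in> lifted_feasible A b K x"
  shows "qp_obj Q c x \<le> Q_hat Q c \<bullet> Y"
proof -
  define X where "X = (\<chi> i j. Y $ Some i $ Some j)"
  have feas: "x \<in> qp_feasible A b" using x by (simp add: local_minimizer_on_def)
  have dnn: "Y \<in> doubly_nonnegative"
    using K Y by (auto simp: K_star_def lifted_feasible_def)
  have YX: "Y = bordered 1 x x X"
    unfolding X_def using dnn Y
    by (intro eq_bordered) (auto simp: doubly_nonnegative_def psd_mat_def lifted_feasible_def)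
  have "psd_mat (X - outer_square x)"
    using dnn by (intro psd_schur_complement) (simp add: YX doubly_nonnegative_def)
  moreover have "column j (X - outer_square x) \<in> lineality_at A x" for j
    using dnn Y by (intro schur_complement_column_lineality[OF bdd feas])
      (simp_all add: YX lifted_feasible_def)
  ultimately have "0 \<le> Q \<bullet> (X - outer_square x)"
    by (intro psd_inner_nonneg_on_subspace[OF subspace_lineality_at])
      (auto intro: local_minimizer_curvature_nonneg[OF x])
  then show ?thesis
    by (simp add: YX Q_hat_inner_bordered inner_diff_right inner_outer_square qp_obj_def)
qed

lemma lifted_value_local_minimizer:
  assumes K: "K \<in> K_star" and bdd: "bounded (qp_feasible A b)"
    and x: "local_minimizer_on (qp_obj Q c) (qp_feasible A b) x"
  shows "lifted_value Q c A b K x = ereal (qp_obj Q c x)"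
  unfolding lifted_value_def
proof (rule antisym)
  have "x \<in> qp_feasible A b" using x by (simp add: local_minimizer_on_def)
  from lift_in_lifted_feasible[OF K this]
  show "(INF Y\<in>lifted_feasible A b K x. ereal (Q_hat Q c \<bullet> Y)) \<le> ereal (qp_obj Q c x)"
    by (rule INF_lower2) (simp add: Q_hat_inner_lift)
  show "ereal (qp_obj Q c x) \<le> (INF Y\<in>lifted_feasible A b K x. ereal (Q_hat Q c \<bullet> Y))"
    using lifted_feasible_lower_bound[OF K bdd x] by (intro INF_greatest) simp
qed

lemma global_minimizer_imp_local:
  "global_minimizer_on f S x \<Longrightarrow> local_minimizer_on f S x"
  by (auto simp: global_minimizer_on_def local_minimizer_on_def intro: exI[of _ 1])

lemma global_minimizer_qp_value:
  "global_minimizer_on (qp_obj Q c) (qp_feasible A b) x \<Longrightarrow> ereal (qp_obj Q c x) = qp_value Q c A b"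
  unfolding qp_value_def global_minimizer_on_def
  by (intro antisym INF_greatest INF_lower) auto

theorem proposition5p3:
  fixes Q :: "real^'n^'n" and c :: "real^'n"
    and A :: "real^'n^'m" and b :: "real^'m"
    and K :: "(real^('n option)^('n option)) set"
  assumes "symmetric_mat Q"
    and "K \<in> K_star"
    and "qp_feasible A b \<noteq> {}"
    and "bounded (qp_feasible A b)"
  shows "(\<forall>x. local_minimizer_on (qp_obj Q c) (qp_feasible A b) x \<longrightarrow>
              lifted_value Q c A b K x = ereal (qp_obj Q c x)) \<and>
         (\<forall>x. global_minimizer_on (qp_obj Q c) (qp_feasible A b) x \<longrightarrow>
              lifted_value Q c A b K x = ereal (qp_obj Q c x) \<and>
              ereal (qp_obj Q c x) = qp_value Q c A b)"
  using lifted_value_local_minimizer[OF assms(2,4)] global_minimizer_imp_local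
    global_minimizer_qp_value by blast

end
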